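(* Let $\mathcal J=\{J_1,\dots,J_m\}$ be an arbitrary cover of $I=\{1,\dots,n\}$. For every $J\in\mathcal J$ let $W^J$ be a Wasserstein matrix for the ideal Gibbs kernel $P^J$ such that $$W^J_{i,j}=\begin{cases}\mathbb I_{[i=j]}, & i\in J^c,\\ 0, & i\in J,\ j\in I\setminus\partial J,\end{cases}\qquad W^J_{i,j}\in[0,1]\ \text{ for } i\in J,\ j\in\partial J .$$ Let $\partial=\bigcup_{J\in\mathcal J}\partial J$ and assume that there is a constant $\lambda<1$ such that for all $J\in\mathcal J$, $$\max_{i\in J\cap\partial}\ \sum_{j\in\partial J}W^J_{i,j}\le\lambda .$$ Let $\mathcal W:=W^{J_m}\cdots W^{J_1}$ be the Wasserstein matrix for $\mathcal P=P^{J_1}\cdots P^{J_m}$, i.e. for one complete sweep of the ideal Gibbs sampler. Then, for every $k\ge1$, $$\|\mathcal W^k\|_\infty\le\lambda^{k-1}\|\mathcal W\|_\infty .$$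
   Context: Setting: $\mathsf X$ is the state space and $\mathsf Y$ the observation space of a hidden Markov model with initial distribution having density $\mu_0$, transition kernel with density $m(x,x')$ with respect to a $\sigma$-finite measure on $\mathsf X$, and observation density $g(x,y)$. Observations $y_{1:n}$ are fixed. The joint smoothing distribution $\phi$ is the probability distribution on $\mathsf X^n$ with density proportional to $\mu_0(x_1)g(x_1,y_1)\prod_{t=2}^n m(x_{t-1},x_t)g(x_t,y_t)$. Notation: $I=\{1,\dots,n\}$. For $J\subset I$: $J^c=I\setminus J$, $x_J=(x_i:i\in J)$, and $\partial J=\{t\in J^c: t+1\in J\text{ or }t-1\in J\}$. $\phi^J_x$ is (a version of) the regular conditional distribution under $\phi$ of $X_J$ given $X_{J^c}=x_{J^c}$; it depends on $x$ only through $x_{\partial J}$. The ideal Gibbs kernel updating block $J$ is $P^J(x,\mathrm dx')=\phi^J_x(\mathrm dx'_J)\,\delta_{x_{J^c}}(\mathrm dx'_{J^c})$ on $\mathsf X^n$. Kernels are composed as $(PQ)(x,\cdot)=\int P(x,\mathrm dy)Q(y,\cdot)$. For $f:\mathsf X^n\to\mathbb R$, $\mathrm{osc}_i(f)=\sup\{|f(x)-f(y)|: x,y\in\mathsf X^n,\ x_j=y_j\ \forall j\ne i\}$, and $f$ has finite oscillation if $\sup_{x,z}|f(x)-f(z)|<\infty$. A (nonnegative) matrix $W=(W_{i,j})_{i,j\in I}$ is a Wasserstein matrix for a Markov kernel $P$ on $\mathsf X^n$ if $\mathrm{osc}_j(Pf)\le\sum_{i\in I}\mathrm{osc}_i(f)W_{i,j}$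 for all $j\in I$ and all $f$ of finite oscillation. If $V,W$ are Wasserstein matrices for $P,Q$ respectively, then $WV$ is one for $PQ$. $\|A\|_\infty=\max_i\sum_j|a_{i,j}|$. A maximum over an empty index set is taken to be $0$. *)

theory Defs
  imports "HOL-Probability.Probability"
begin

section \<open>Hidden Markov models and the joint smoothing distribution\<close>

text \<open>
  The state space \<open>M\<close> carries the \<open>\<sigma>\<close>-finite reference measure for \<open>mu0\<close> and \<open>m\<close>;
  the observation space \<open>N\<close> carries the reference measure for the observation density \<open>g\<close>.
\<close>

locale hidden_markov_model = sigma_finite_measure M
  for M :: "'a measure" +
  fixes N :: "'b measure"
    and mu0 :: "'a \<Rightarrow> real"
    and m :: "'a \<Rightarrow> 'a \<Rightarrow> real"
    and g :: "'a \<Rightarrow> 'b \<Rightarrow> real"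
  assumes mu0_measurable: "mu0 \<in> borel_measurable M"
    and mu0_nonneg: "\<And>x. x \<in> space M \<Longrightarrow> 0 \<le> mu0 x"
    and mu0_prob: "prob_space (density M (\<lambda>x. ennreal (mu0 x)))"
    and m_measurable: "(\<lambda>(x, x'). m x x') \<in> borel_measurable (M \<Otimes>\<^sub>M M)"
    and m_nonneg: "\<And>x x'. x \<in> space M \<Longrightarrow> x' \<in> space M \<Longrightarrow> 0 \<le> m x x'"
    and m_prob: "\<And>x. x \<in> space M \<Longrightarrow> prob_space (density M (\<lambda>x'. ennreal (m x x')))"
    and g_measurable: "(\<lambda>(x, y). g x y) \<in> borel_measurable (M \<Otimes>\<^sub>M N)"
    and g_nonneg: "\<And>x y. x \<in> space M \<Longrightarrow> y \<in> space N \<Longrightarrow> 0 \<le> g x y"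
    and g_prob: "\<And>x. x \<in> space M \<Longrightarrow> prob_space (density N (\<lambda>y. ennreal (g x y)))"

text \<open>
  For \<open>J \<subseteq> {1..n}\<close>, \<open>path_space M J\<close> is \<open>X\<^sup>J\<close>; its elements are functions that are
  \<open>undefined\<close> outside \<open>J\<close>, so \<open>x\<^sub>J\<close> is \<open>restrict x J\<close>.
\<close>

abbreviation path_space :: "'a measure \<Rightarrow> nat set \<Rightarrow> (nat \<Rightarrow> 'a) measure" where
  "path_space M J \<equiv> Pi\<^sub>M J (\<lambda>_. M)"

definition smoothing_weight ::
  "nat \<Rightarrow> ('a \<Rightarrow> real) \<Rightarrow> ('a \<Rightarrow> 'a \<Rightarrow> real) \<Rightarrow> ('a \<Rightarrow> 'b \<Rightarrow> real) \<Rightarrow> (nat \<Rightarrow> 'b) \<Rightarrow> (nat \<Rightarrow> 'a) \<Rightarrow> real"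
where
  "smoothing_weight n mu0 m g y x =
     mu0 (x 1) * g (x 1) (y 1) * (\<Prod>t = 2..n. m (x (t - 1)) (x t) * g (x t) (y t))"

definition smoothing_normalizer ::
  "nat \<Rightarrow> 'a measure \<Rightarrow> ('a \<Rightarrow> real) \<Rightarrow> ('a \<Rightarrow> 'a \<Rightarrow> real) \<Rightarrow> ('a \<Rightarrow> 'b \<Rightarrow> real) \<Rightarrow> (nat \<Rightarrow> 'b) \<Rightarrow> ennreal"
where
  "smoothing_normalizer n M mu0 m g y =
     (\<integral>\<^sup>+ x. ennreal (smoothing_weight n mu0 m g y x) \<partial>path_space M {1..n})"

text \<open>This is a probability measure only if the normalizer is neither \<open>0\<close> nor \<open>\<infinity>\<close>.\<close>

definition joint_smoothing ::
  "nat \<Rightarrow> 'a measure \<Rightarrow> ('a \<Rightarrow> real) \<Rightarrow> ('a \<Rightarrow> 'a \<Rightarrow> real) \<Rightarrow> ('a \<Rightarrow> 'b \<Rightarrow> real) \<Rightarrow> (nat \<Rightarrow> 'b)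
     \<Rightarrow> (nat \<Rightarrow> 'a) measure"
where
  "joint_smoothing n M mu0 m g y =
     density (path_space M {1..n})
       (\<lambda>x. ennreal (smoothing_weight n mu0 m g y x) / smoothing_normalizer n M mu0 m g y)"


section \<open>Blocks and ideal Gibbs kernels\<close>

definition boundary :: "nat \<Rightarrow> nat set \<Rightarrow> nat set" where
  "boundary n J = {t \<in> {1..n} - J. t + 1 \<in> J \<or> t - 1 \<in> J}"

definition regular_conditional_distribution ::
  "'p measure \<Rightarrow> 's measure \<Rightarrow> ('p \<Rightarrow> 's) \<Rightarrow> 't measure \<Rightarrow> ('p \<Rightarrow> 't) \<Rightarrow> ('t \<Rightarrow> 's measure) \<Rightarrow> bool"
where
  "regular_conditional_distribution P S X T Y K \<longleftrightarrow>
     K \<in> measurable T (prob_algebra S) \<and>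
     (\<forall>A \<in> sets S. \<forall>B \<in> sets T.
        emeasure P {w \<in> space P. X w \<in> A \<and> Y w \<in> B}
          = (\<integral>\<^sup>+ w. emeasure (K (Y w)) A * indicator B (Y w) \<partial>P))"

text \<open>
  A version of the conditional distribution of \<open>X\<^sub>J\<close> given the remaining coordinates
  under \<open>phi\<close>. The Markov structure gives dependence on the boundary only up to null sets,
  so requiring it everywhere is a choice of version.
\<close>

definition block_conditional ::
  "nat \<Rightarrow> 'a measure \<Rightarrow> (nat \<Rightarrow> 'a) measure \<Rightarrow> nat set \<Rightarrow> ((nat \<Rightarrow> 'a) \<Rightarrow> (nat \<Rightarrow> 'a) measure) \<Rightarrow> bool"
where
  "block_conditional n M phi J K \<longleftrightarrow>
     regular_conditional_distribution phi
       (path_space M J) (\<lambda>x. restrict x J)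
       (path_space M ({1..n} - J)) (\<lambda>x. restrict x ({1..n} - J)) K \<and>
     (\<forall>x \<in> space (path_space M ({1..n} - J)). \<forall>x' \<in> space (path_space M ({1..n} - J)).
        (\<forall>i \<in> boundary n J. x i = x' i) \<longrightarrow> K x = K x')"

definition gibbs_kernel ::
  "nat \<Rightarrow> 'a measure \<Rightarrow> nat set \<Rightarrow> ((nat \<Rightarrow> 'a) \<Rightarrow> (nat \<Rightarrow> 'a) measure)
     \<Rightarrow> (nat \<Rightarrow> 'a) \<Rightarrow> (nat \<Rightarrow> 'a) measure"
where
  "gibbs_kernel n M J K x =
     distr (K (restrict x ({1..n} - J))
              \<Otimes>\<^sub>M return (path_space M ({1..n} - J)) (restrict x ({1..n} - J)))
       (path_space M {1..n}) (merge J ({1..n} - J))"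

text \<open>\<open>P\<^sub>1\<close> is applied first in \<open>kernel_prod S [P\<^sub>1, \<dots>, P\<^sub>m] = P\<^sub>1 \<cdots> P\<^sub>m\<close>.\<close>

fun kernel_prod :: "'s measure \<Rightarrow> ('s \<Rightarrow> 's measure) list \<Rightarrow> 's \<Rightarrow> 's measure" where
  "kernel_prod S [] = return S"
| "kernel_prod S (P # Ps) = (\<lambda>x. Giry_Monad.bind (P x) (kernel_prod S Ps))"


section \<open>Matrices indexed by \<open>{1..n}\<close>\<close>

text \<open>
  Matrices are functions of type \<open>nat \<Rightarrow> nat \<Rightarrow> real\<close> of which only the entries with both
  indices in \<open>{1..n}\<close> matter.
\<close>

definition mat_id :: "nat \<Rightarrow> nat \<Rightarrow> real" where
  "mat_id i j = (if i = j then 1 else 0)"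

definition mat_mult :: "nat \<Rightarrow> (nat \<Rightarrow> nat \<Rightarrow> real) \<Rightarrow> (nat \<Rightarrow> nat \<Rightarrow> real) \<Rightarrow> nat \<Rightarrow> nat \<Rightarrow> real" where
  "mat_mult n A B i j = (\<Sum>l \<in> {1..n}. A i l * B l j)"

definition mat_power :: "nat \<Rightarrow> (nat \<Rightarrow> nat \<Rightarrow> real) \<Rightarrow> nat \<Rightarrow> nat \<Rightarrow> nat \<Rightarrow> real" where
  "mat_power n A k = (mat_mult n A ^^ k) mat_id"

text \<open>\<open>mat_prod_rev n [A\<^sub>1, \<dots>, A\<^sub>m] = A\<^sub>m \<cdots> A\<^sub>1\<close>.\<close>

fun mat_prod_rev :: "nat \<Rightarrow> (nat \<Rightarrow> nat \<Rightarrow> real) list \<Rightarrow> nat \<Rightarrow> nat \<Rightarrow> real" where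
  "mat_prod_rev n [] = mat_id"
| "mat_prod_rev n (A # As) = mat_mult n (mat_prod_rev n As) A"

definition max_over :: "'i set \<Rightarrow> ('i \<Rightarrow> real) \<Rightarrow> real" where
  "max_over S f = (if S = {} then 0 else Max (f ` S))"

definition mat_norm_inf :: "nat \<Rightarrow> (nat \<Rightarrow> nat \<Rightarrow> real) \<Rightarrow> real" where
  "mat_norm_inf n A = max_over {1..n} (\<lambda>i. \<Sum>j \<in> {1..n}. \<bar>A i j\<bar>)"


section \<open>Oscillations and Wasserstein matrices\<close>

text \<open>For a function of finite oscillation the supremum is over a bounded set.\<close>

definition osc :: "nat \<Rightarrow> 'a measure \<Rightarrow> nat \<Rightarrow> ((nat \<Rightarrow> 'a) \<Rightarrow> real) \<Rightarrow> real" where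
  "osc n M i f = Sup {\<bar>f x - f y\<bar> | x y.
     x \<in> space (path_space M {1..n}) \<and> y \<in> space (path_space M {1..n}) \<and>
     (\<forall>j \<in> {1..n}. j \<noteq> i \<longrightarrow> x j = y j)}"

definition finite_oscillation :: "nat \<Rightarrow> 'a measure \<Rightarrow> ((nat \<Rightarrow> 'a) \<Rightarrow> real) \<Rightarrow> bool" where
  "finite_oscillation n M f \<longleftrightarrow>
     bdd_above {\<bar>f x - f z\<bar> | x z.
       x \<in> space (path_space M {1..n}) \<and> z \<in> space (path_space M {1..n})}"

definition wasserstein_matrix ::
  "nat \<Rightarrow> 'a measure \<Rightarrow> ((nat \<Rightarrow> 'a) \<Rightarrow> (nat \<Rightarrow> 'a) measure) \<Rightarrow> (nat \<Rightarrow> nat \<Rightarrow> real) \<Rightarrow> bool"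
where
  "wasserstein_matrix n M P W \<longleftrightarrow>
     (\<forall>i \<in> {1..n}. \<forall>j \<in> {1..n}. 0 \<le> W i j) \<and>
     (\<forall>f. f \<in> borel_measurable (path_space M {1..n}) \<and> finite_oscillation n M f \<longrightarrow>
        (\<forall>j \<in> {1..n}. osc n M j (\<lambda>x. \<integral>z. f z \<partial>P x) \<le> (\<Sum>i \<in> {1..n}. osc n M i f * W i j)))"

end

theory Submission
  imports Defs
begin

text \<open>
  The claim has two halves.

  The product matrix is a Wasserstein matrix for the sweep because Wasserstein matrices
  compose: \<open>P Q f = P (Q f)\<close>, so \<open>osc\<^sub>j (P Q f)\<close> is controlled by the oscillations of \<open>Q f\<close>,
  and these by the oscillations of \<open>f\<close> (lemma \<open>wasserstein_matrix_bind\<close>). What has to be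
  checked is that \<open>Q f\<close> is again an admissible test function, and for this it suffices that the
  kernels are measurable and sub-stochastic. The Gibbs kernels have this property because the
  conditional distributions do.

  The norm bound is purely algebraic. Let \<open>D\<close> be the union of all block boundaries, and let the
  matrices act on vectors. The matrix of block \<open>J\<close> leaves the coordinates outside \<open>J\<close> alone
  and overwrites each coordinate in \<open>J\<close> by a combination of coordinates in \<open>D\<close>; if the
  overwritten coordinate itself lies in \<open>D\<close>, the weights sum to at most \<open>\<lambda>\<close>. If a vector is
  at most \<open>c\<close> on \<open>D\<close>, it stays so, and each coordinate in \<open>D\<close> drops to at most \<open>\<lambda> c\<close> when it
  is first overwritten and does not exceed this value later. As the blocks cover everything, a
  sweep maps vectors bounded by \<open>c\<close> on \<open>D\<close> to vectors bounded by \<open>\<lambda> c\<close> on \<open>D\<close>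
  (lemma \<open>sweep_contracts_boundary\<close>). Interior coordinates need not contract, but after a
  complete sweep every coordinate is a function of the values on \<open>D\<close> alone
  (lemma \<open>sweep_mono\<close>). Starting from the all-ones vector, \<open>k - 1\<close> sweeps bring the values on
  \<open>D\<close> down to \<open>\<lambda>\<^bsup>k - 1\<^esup>\<close>, and the last sweep turns this into a bound by
  \<open>\<lambda>\<^bsup>k - 1\<^esup>\<close> times the largest row sum on all coordinates.
\<close>


section \<open>Composition of Wasserstein matrices\<close>

lemma finite_oscillation_iff_bounded:
  "finite_oscillation n M f \<longleftrightarrow> (\<exists>B. \<forall>x\<in>space (path_space M {1..n}). \<bar>f x\<bar> \<le> B)"
proof
  assume "finite_oscillation n M f"
  then obtain C where C: "\<bar>f x - f z\<bar> \<le> C"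
    if "x \<in> space (path_space M {1..n})" "z \<in> space (path_space M {1..n})" for x z
    unfolding finite_oscillation_def bdd_above_def by blast
  show "\<exists>B. \<forall>x\<in>space (path_space M {1..n}). \<bar>f x\<bar> \<le> B"
  proof (cases "space (path_space M {1..n}) = {}")
    case False
    then obtain z where z: "z \<in> space (path_space M {1..n})"
      by blast
    have "\<bar>f x\<bar> \<le> C + \<bar>f z\<bar>" if "x \<in> space (path_space M {1..n})" for x
      using C[OF that z] by linarith
    then show ?thesis
      by blast
  qed blast
next
  assume "\<exists>B. \<forall>x\<in>space (path_space M {1..n}). \<bar>f x\<bar> \<le> B"
  then obtain B where B: "\<bar>f x\<bar> \<le> B" if "x \<in> space (path_space M {1..n})" for x
    by blast
  have "\<bar>f x - f z\<bar> \<le> 2 * B"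
    if "x \<in> space (path_space M {1..n})" "z \<in> space (path_space M {1..n})" for x z
    using B[OF that(1)] B[OF that(2)] by linarith
  then show "finite_oscillation n M f"
    unfolding finite_oscillation_def bdd_above_def by blast
qed

lemma osc_cong:
  assumes "\<And>x. x \<in> space (path_space M {1..n}) \<Longrightarrow> f x = f' x"
  shows "osc n M i f = osc n M i f'"
proof -
  have "{\<bar>f x - f y\<bar> | x y. x \<in> space (path_space M {1..n}) \<and> y \<in> space (path_space M {1..n}) \<and>
          (\<forall>j \<in> {1..n}. j \<noteq> i \<longrightarrow> x j = y j)} =
        {\<bar>f' x - f' y\<bar> | x y. x \<in> space (path_space M {1..n}) \<and> y \<in> space (path_space M {1..n}) \<and>
          (\<forall>j \<in> {1..n}. j \<noteq> i \<longrightarrow> x j = y j)}"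
    using assms by (intro Collect_cong ex_cong1) (auto simp del: space_PiM)
  then show ?thesis
    unfolding osc_def by simp
qed

lemma (in subprob_space) abs_integral_le_bound:
  fixes f :: "'a \<Rightarrow> real"
  assumes f: "f \<in> borel_measurable M" and B: "\<And>x. x \<in> space M \<Longrightarrow> \<bar>f x\<bar> \<le> B"
  shows "\<bar>\<integral>x. f x \<partial>M\<bar> \<le> B"
proof -
  obtain x where "x \<in> space M"
    using subprob_not_empty by blast
  then have "0 \<le> B"
    using B[of x] by linarith
  have int: "integrable M f"
    using f B by (intro integrable_const_bound[where B = B]) auto
  have "\<bar>\<integral>x. f x \<partial>M\<bar> \<le> (\<integral>x. \<bar>f x\<bar> \<partial>M)"
    using integral_norm_bound[of M f] by simp
  also have "\<dots> \<le> (\<integral>x. B \<partial>M)"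
    using int B by (intro integral_mono) auto
  also have "\<dots> \<le> B"
    using subprob_measure_le_1[of "space M"] \<open>0 \<le> B\<close> by (simp add: mult_left_le_one_le)
  finally show ?thesis .
qed

lemma wasserstein_matrix_return:
  "wasserstein_matrix n M (return (path_space M {1..n})) mat_id"
proof -
  have "osc n M j (\<lambda>x. \<integral>z. f z \<partial>return (path_space M {1..n}) x)
          \<le> (\<Sum>i\<in>{1..n}. osc n M i f * mat_id i j)"
    if f: "f \<in> borel_measurable (path_space M {1..n})" and j: "j \<in> {1..n}" for f j
  proof -
    have "(\<Sum>i\<in>{1..n}. osc n M i f * mat_id i j) = osc n M j f"
      using j by (simp add: mat_id_def if_distrib cong: if_cong)
    moreover have "osc n M j (\<lambda>x. \<integral>z. f z \<partial>return (path_space M {1..n}) x) = osc n M j f"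
      using f by (intro osc_cong integral_return)
    ultimately show ?thesis
      by simp
  qed
  then show ?thesis
    unfolding wasserstein_matrix_def by (simp add: mat_id_def)
qed

text \<open>
  The order of the factors is reversed because the oscillations of \<open>f\<close> enter as a row vector:
  \<open>Q\<close> acts first on \<open>f\<close>, so \<open>W\<close> is the first matrix to be multiplied from the right.
\<close>

lemma wasserstein_matrix_bind:
  fixes P Q :: "(nat \<Rightarrow> 'a) \<Rightarrow> (nat \<Rightarrow> 'a) measure"
  assumes P: "P \<in> path_space M {1..n} \<rightarrow>\<^sub>M subprob_algebra (path_space M {1..n})"
    and Q: "Q \<in> path_space M {1..n} \<rightarrow>\<^sub>M subprob_algebra (path_space M {1..n})"
    and V: "wasserstein_matrix n M P V" and W: "wasserstein_matrix n M Q W"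
  shows "wasserstein_matrix n M (\<lambda>x. Giry_Monad.bind (P x) Q) (mat_mult n W V)"
proof -
  let ?S = "path_space M {1..n}"
  have V0: "0 \<le> V i j" and W0: "0 \<le> W i j" if "i \<in> {1..n}" "j \<in> {1..n}" for i j
    using V W that unfolding wasserstein_matrix_def by blast+
  have Vosc: "osc n M j (\<lambda>x. \<integral>z. f z \<partial>P x) \<le> (\<Sum>i\<in>{1..n}. osc n M i f * V i j)"
    and Wosc: "osc n M j (\<lambda>x. \<integral>z. f z \<partial>Q x) \<le> (\<Sum>i\<in>{1..n}. osc n M i f * W i j)"
    if "f \<in> borel_measurable ?S" "finite_oscillation n M f" "j \<in> {1..n}" for f j
    using V W that unfolding wasserstein_matrix_def by blast+
  have "osc n M j (\<lambda>x. \<integral>z. f z \<partial>Giry_Monad.bind (P x) Q)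
          \<le> (\<Sum>i\<in>{1..n}. osc n M i f * mat_mult n W V i j)"
    if f: "f \<in> borel_measurable ?S" and fin: "finite_oscillation n M f" and j: "j \<in> {1..n}" for f j
  proof -
    obtain B where B: "\<bar>f x\<bar> \<le> B" if "x \<in> space ?S" for x
      using fin finite_oscillation_iff_bounded by blast
    let ?Qf = "\<lambda>x. \<integral>z. f z \<partial>Q x"
    have Qf_meas: "?Qf \<in> borel_measurable ?S"
      using measurable_compose[OF Q integral_measurable_subprob_algebra[OF f]] .
    have Qf_bound: "\<bar>?Qf x\<bar> \<le> B" if x: "x \<in> space ?S" for x
    proof (rule subprob_space.abs_integral_le_bound)
      show "subprob_space (Q x)"
        using Q x by (rule subprob_space_kernel)
      show "f \<in> borel_measurable (Q x)"
        using f sets_kernel[OF Q x] by (simp cong: measurable_cong_sets)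
      show "\<bar>f z\<bar> \<le> B" if "z \<in> space (Q x)" for z
        using that B sets_eq_imp_space_eq[OF sets_kernel[OF Q x]] by blast
    qed
    have Qf_fin: "finite_oscillation n M ?Qf"
      using Qf_bound finite_oscillation_iff_bounded by blast
    have bind: "(\<integral>z. f z \<partial>Giry_Monad.bind (P x) Q) = (\<integral>w. ?Qf w \<partial>P x)" if x: "x \<in> space ?S" for x
    proof (rule integral_bind[OF f B, where B' = 1])
      have sets_P: "sets (P x) = sets ?S"
        using P x by (rule sets_kernel)
      then have space_P: "space (P x) = space ?S"
        by (rule sets_eq_imp_space_eq)
      show "Q \<in> P x \<rightarrow>\<^sub>M subprob_algebra ?S"
        using Q sets_P by (simp cong: measurable_cong_sets)
      show "finite_measure (P x)"
        using subprob_space_kernel[OF P x] by (rule subprob_space.axioms)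
      show "AE w in P x. emeasure (Q w) (space (Q w)) \<le> ennreal 1"
        using subprob_space.emeasure_space_le_1[OF subprob_space_kernel[OF Q]] space_P
        by (intro AE_I2) (simp del: space_PiM)
    qed
    have "osc n M j (\<lambda>x. \<integral>z. f z \<partial>Giry_Monad.bind (P x) Q) = osc n M j (\<lambda>x. \<integral>w. ?Qf w \<partial>P x)"
      using bind by (rule osc_cong)
    also have "\<dots> \<le> (\<Sum>l\<in>{1..n}. osc n M l ?Qf * V l j)"
      using Vosc Qf_meas Qf_fin j by blast
    also have "\<dots> \<le> (\<Sum>l\<in>{1..n}. (\<Sum>i\<in>{1..n}. osc n M i f * W i l) * V l j)"
      using Wosc[OF f fin] V0 j by (intro sum_mono mult_right_mono) auto
    also have "\<dots> = (\<Sum>i\<in>{1..n}. osc n M i f * mat_mult n W V i j)"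
      unfolding mat_mult_def sum_distrib_left sum_distrib_right
      by (subst sum.swap) (simp add: mult.assoc)
    finally show ?thesis .
  qed
  moreover have "0 \<le> mat_mult n W V i j" if "i \<in> {1..n}" "j \<in> {1..n}" for i j
    using V0 W0 that unfolding mat_mult_def by (intro sum_nonneg mult_nonneg_nonneg) auto
  ultimately show ?thesis
    unfolding wasserstein_matrix_def by blast
qed

lemma kernel_prod_measurable:
  assumes "\<And>P. P \<in> set Ps \<Longrightarrow> P \<in> S \<rightarrow>\<^sub>M subprob_algebra S"
  shows "kernel_prod S Ps \<in> S \<rightarrow>\<^sub>M subprob_algebra S"
  using assms
proof (induction Ps)
  case (Cons P Ps)
  then have "P \<in> S \<rightarrow>\<^sub>M subprob_algebra S" "kernel_prod S Ps \<in> S \<rightarrow>\<^sub>M subprob_algebra S"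
    by auto
  then show ?case
    by (simp add: measurable_bind2)
qed simp

lemma wasserstein_matrix_kernel_prod:
  assumes "\<And>J. J \<in> set Js \<Longrightarrow> P J \<in> path_space M {1..n} \<rightarrow>\<^sub>M subprob_algebra (path_space M {1..n})"
    and "\<And>J. J \<in> set Js \<Longrightarrow> wasserstein_matrix n M (P J) (W J)"
  shows "wasserstein_matrix n M (kernel_prod (path_space M {1..n}) (map P Js))
           (mat_prod_rev n (map W Js))"
  using assms
proof (induction Js)
  case Nil
  show ?case
    using wasserstein_matrix_return by simp
next
  case (Cons J Js)
  have "kernel_prod (path_space M {1..n}) (map P Js)
          \<in> path_space M {1..n} \<rightarrow>\<^sub>M subprob_algebra (path_space M {1..n})"
    using Cons.prems(1) by (intro kernel_prod_measurable) auto
  then show ?case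
    using Cons by (simp add: wasserstein_matrix_bind)
qed

lemma gibbs_kernel_measurable:
  assumes J: "J \<subseteq> {1..n}"
    and K: "K \<in> path_space M ({1..n} - J) \<rightarrow>\<^sub>M prob_algebra (path_space M J)"
  shows "gibbs_kernel n M J K \<in> path_space M {1..n} \<rightarrow>\<^sub>M subprob_algebra (path_space M {1..n})"
proof -
  let ?C = "path_space M ({1..n} - J)"
  have restr: "(\<lambda>x. restrict x ({1..n} - J)) \<in> path_space M {1..n} \<rightarrow>\<^sub>M ?C"
    by (rule measurable_restrict_subset) auto
  have merge: "merge J ({1..n} - J) \<in> path_space M J \<Otimes>\<^sub>M ?C \<rightarrow>\<^sub>M path_space M {1..n}"
    using measurable_merge[of J "{1..n} - J" "\<lambda>_. M"] J by (simp add: Un_absorb1)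
  have "(\<lambda>z. K z \<Otimes>\<^sub>M return ?C z) \<in> ?C \<rightarrow>\<^sub>M subprob_algebra (path_space M J \<Otimes>\<^sub>M ?C)"
    using measurable_prob_algebraD[OF K] return_measurable by (rule measurable_pair_measure)
  from measurable_compose[OF measurable_compose[OF restr this] measurable_distr[OF merge]]
  show ?thesis
    unfolding gibbs_kernel_def .
qed


section \<open>Contraction of a sweep on the block boundaries\<close>

definition mat_vec :: "nat \<Rightarrow> (nat \<Rightarrow> nat \<Rightarrow> real) \<Rightarrow> (nat \<Rightarrow> real) \<Rightarrow> nat \<Rightarrow> real" where
  "mat_vec n A v i = (\<Sum>j\<in>{1..n}. A i j * v j)"

lemma mat_vec_mat_id: "i \<in> {1..n} \<Longrightarrow> mat_vec n mat_id v i = v i"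
  by (simp add: mat_vec_def mat_id_def if_distrib[of "\<lambda>a. a * _"] cong: if_cong)

lemma mat_vec_mat_mult: "mat_vec n (mat_mult n A B) v = mat_vec n A (mat_vec n B v)"
proof
  fix i
  show "mat_vec n (mat_mult n A B) v i = mat_vec n A (mat_vec n B v) i"
    unfolding mat_vec_def mat_mult_def sum_distrib_left sum_distrib_right
    by (subst sum.swap) (simp add: mult.assoc)
qed

lemma mat_vec_const: "mat_vec n A (\<lambda>_. c) i = c * mat_vec n A (\<lambda>_. 1) i"
  by (simp add: mat_vec_def sum_distrib_left mult.commute)

lemma mat_power_Suc: "mat_power n A (Suc k) = mat_mult n A (mat_power n A k)"
  by (simp add: mat_power_def)

lemma mat_power_nonneg:
  assumes "\<And>i j. i \<in> {1..n} \<Longrightarrow> j \<in> {1..n} \<Longrightarrow> 0 \<le> A i j"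
    and "i \<in> {1..n}" "j \<in> {1..n}"
  shows "0 \<le> mat_power n A k i j"
  using assms(2,3)
proof (induction k arbitrary: i j)
  case 0
  then show ?case
    by (simp add: mat_power_def mat_id_def)
next
  case (Suc k)
  then show ?case
    unfolding mat_power_Suc mat_mult_def using assms(1)
    by (intro sum_nonneg mult_nonneg_nonneg) auto
qed

text \<open>This reduces norm estimates to following the all-ones vector through the updates.\<close>

lemma mat_norm_inf_nonneg_matrix:
  assumes "1 \<le> n" and "\<And>i j. i \<in> {1..n} \<Longrightarrow> j \<in> {1..n} \<Longrightarrow> 0 \<le> A i j"
  shows "mat_norm_inf n A = Max (mat_vec n A (\<lambda>_. 1) ` {1..n})"
proof -
  have "(\<lambda>i. \<Sum>j\<in>{1..n}. \<bar>A i j\<bar>) ` {1..n} = mat_vec n A (\<lambda>_. 1) ` {1..n}"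
    using assms(2) by (intro image_cong) (auto simp: mat_vec_def)
  then show ?thesis
    using assms(1) by (simp add: mat_norm_inf_def max_over_def)
qed

text \<open>
  The action of one block matrix, with all block boundaries merged into the single set \<open>D\<close>:
  \<open>J\<close> may meet \<open>D\<close> in the boundary points of other blocks, and these are the rows whose sums contract.
\<close>

definition block_update ::
  "nat \<Rightarrow> nat set \<Rightarrow> real \<Rightarrow> nat set \<Rightarrow> (nat \<Rightarrow> nat \<Rightarrow> real) \<Rightarrow> bool"
where
  "block_update n D lam J A \<longleftrightarrow> J \<subseteq> {1..n} \<and>
     (\<forall>i\<in>{1..n}. \<forall>j\<in>{1..n}. 0 \<le> A i j) \<and>
     (\<forall>i\<in>{1..n} - J. \<forall>j\<in>{1..n}. A i j = (if i = j then 1 else 0)) \<and>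
     (\<forall>i\<in>J. \<forall>j\<in>{1..n} - D. A i j = 0) \<and>
     (\<forall>i\<in>J \<inter> D. (\<Sum>j\<in>D. A i j) \<le> lam)"

lemma block_update_outside:
  assumes "block_update n D lam J A" "i \<in> {1..n} - J"
  shows "mat_vec n A v i = v i"
proof -
  have "mat_vec n A v i = mat_vec n mat_id v i"
    using assms unfolding mat_vec_def block_update_def mat_id_def by (intro sum.cong) auto
  then show ?thesis
    using assms(2) mat_vec_mat_id by simp
qed

lemma block_update_inside:
  assumes "D \<subseteq> {1..n}" "block_update n D lam J A" "i \<in> J"
  shows "mat_vec n A v i = (\<Sum>j\<in>D. A i j * v j)"
  unfolding mat_vec_def using assms by (intro sum.mono_neutral_right) (auto simp: block_update_def)

lemma block_update_nonneg:
  assumes "D \<subseteq> {1..n}" "block_update n D lam J A" "i \<in> J" "j \<in> D"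
  shows "0 \<le> A i j"
  using assms unfolding block_update_def by blast

lemma block_update_mono:
  assumes D: "D \<subseteq> {1..n}" and A: "block_update n D lam J A"
    and S: "S \<subseteq> {1..n}" and le: "\<And>i. i \<in> D \<union> S \<Longrightarrow> u i \<le> v i"
    and i: "i \<in> D \<union> (S \<union> J)"
  shows "mat_vec n A u i \<le> mat_vec n A v i"
proof (cases "i \<in> J")
  case True
  then show ?thesis
    using block_update_nonneg[OF D A] le
    by (simp add: block_update_inside[OF D A] sum_mono mult_left_mono)
next
  case False
  then have "i \<in> {1..n} - J" "i \<in> D \<union> S"
    using i D S by auto
  then show ?thesis
    using block_update_outside[OF A] le by metis
qed

lemma block_update_bound:
  assumes D: "D \<subseteq> {1..n}" and A: "block_update n D lam J A"
    and c: "0 \<le> c" and v: "\<And>j. j \<in> D \<Longrightarrow> v j \<le> c" and i: "i \<in> J \<inter> D"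
  shows "mat_vec n A v i \<le> lam * c"
proof -
  have "mat_vec n A v i = (\<Sum>j\<in>D. A i j * v j)"
    using i block_update_inside[OF D A] by blast
  also have "\<dots> \<le> (\<Sum>j\<in>D. A i j * c)"
    using block_update_nonneg[OF D A] v i by (intro sum_mono mult_left_mono) auto
  also have "\<dots> = (\<Sum>j\<in>D. A i j) * c"
    by (simp add: sum_distrib_right)
  also have "\<dots> \<le> lam * c"
    using A c i unfolding block_update_def by (intro mult_right_mono) auto
  finally show ?thesis .
qed

text \<open>
  A coordinate covered by some block is overwritten by a nonnegative combination of coordinates
  in \<open>D\<close>, so from then on the comparison on \<open>D\<close> extends to it. The set \<open>S\<close> collects the
  coordinates on which the comparison has already been achieved and makes the induction work.
\<close>

lemma sweep_mono:
  assumes D: "D \<subseteq> {1..n}"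
    and "\<And>J. J \<in> set Js \<Longrightarrow> block_update n D lam J (W J)"
    and "S \<subseteq> {1..n}" and "\<And>i. i \<in> D \<union> S \<Longrightarrow> u i \<le> v i"
    and "i \<in> D \<union> S \<union> \<Union>(set Js)"
  shows "mat_vec n (mat_prod_rev n (map W Js)) u i \<le> mat_vec n (mat_prod_rev n (map W Js)) v i"
  using assms(2-)
proof (induction Js arbitrary: S u v)
  case Nil
  then have "i \<in> {1..n}"
    using D by auto
  then show ?case
    using Nil by (simp add: mat_vec_mat_id)
next
  case (Cons J Js)
  have A: "block_update n D lam J (W J)"
    using Cons.prems(1) by simp
  show ?case
    unfolding list.map mat_prod_rev.simps mat_vec_mat_mult
  proof (rule Cons.IH[where S = "S \<union> J"])
    show "S \<union> J \<subseteq> {1..n}"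
      using Cons.prems(2) A unfolding block_update_def by blast
    show "mat_vec n (W J) u k \<le> mat_vec n (W J) v k" if "k \<in> D \<union> (S \<union> J)" for k
      using block_update_mono[OF D A Cons.prems(2,3) that] .
  qed (use Cons.prems in auto)
qed

text \<open>
  Each coordinate in \<open>D\<close> drops to \<open>\<lambda> c\<close> when its block is first visited, and \<open>S\<close> collects
  those where this has already happened. Since \<open>\<lambda> \<le> 1\<close>, the bound \<open>c\<close> on all of \<open>D\<close> persists,
  so later visits produce values of at most \<open>\<lambda> c\<close> again.
\<close>

lemma sweep_contracts_boundary:
  assumes D: "D \<subseteq> {1..n}" and c: "0 \<le> c" and lam: "lam \<le> 1"
    and "\<And>J. J \<in> set Js \<Longrightarrow> block_update n D lam J (W J)"
    and "\<And>i. i \<in> D \<Longrightarrow> v i \<le> c"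
    and "S \<subseteq> D" and "\<And>i. i \<in> S \<Longrightarrow> v i \<le> lam * c"
    and "i \<in> S \<union> (D \<inter> \<Union>(set Js))"
  shows "mat_vec n (mat_prod_rev n (map W Js)) v i \<le> lam * c"
  using assms(4-)
proof (induction Js arbitrary: S v)
  case Nil
  then have "i \<in> {1..n}"
    using D by auto
  then show ?case
    using Nil by (simp add: mat_vec_mat_id)
next
  case (Cons J Js)
  have A: "block_update n D lam J (W J)"
    using Cons.prems(1) by simp
  have drop: "mat_vec n (W J) v k \<le> lam * c" if "k \<in> J \<inter> D" for k
    using block_update_bound[OF D A c _ that] Cons.prems(2) by blast
  have keep: "mat_vec n (W J) v k = v k" if "k \<in> D - J" for k
    using block_update_outside[OF A] D that by blast
  have "lam * c \<le> c"
    using mult_right_mono[OF lam c] by simp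
  show ?case
    unfolding list.map mat_prod_rev.simps mat_vec_mat_mult
  proof (rule Cons.IH[where S = "S \<union> (D \<inter> J)"])
    show "mat_vec n (W J) v k \<le> c" if "k \<in> D" for k
      using drop[of k] keep[of k] Cons.prems(2)[OF that] \<open>lam * c \<le> c\<close> that
      by (cases "k \<in> J") auto
    show "mat_vec n (W J) v k \<le> lam * c" if "k \<in> S \<union> (D \<inter> J)" for k
      using drop[of k] keep[of k] Cons.prems(3,4) that by (cases "k \<in> J") auto
  qed (use Cons.prems in auto)
qed

lemma mat_prod_rev_nonneg:
  assumes "\<And>A i j. A \<in> set As \<Longrightarrow> i \<in> {1..n} \<Longrightarrow> j \<in> {1..n} \<Longrightarrow> 0 \<le> A i j"
    and "i \<in> {1..n}" "j \<in> {1..n}"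
  shows "0 \<le> mat_prod_rev n As i j"
  using assms
proof (induction As arbitrary: i j)
  case (Cons A As)
  then show ?case
    by (auto simp: mat_mult_def intro!: sum_nonneg mult_nonneg_nonneg)
qed (simp add: mat_id_def)

lemma norm_power_sweep_le:
  assumes n: "1 \<le> n" and D: "D \<subseteq> {1..n}" and lam: "0 \<le> lam" "lam \<le> 1"
    and W: "\<And>J. J \<in> set Js \<Longrightarrow> block_update n D lam J (W J)"
    and cover: "\<Union>(set Js) = {1..n}"
  defines "A \<equiv> mat_prod_rev n (map W Js)"
  shows "mat_norm_inf n (mat_power n A (Suc k)) \<le> lam ^ k * mat_norm_inf n A"
proof -
  have A0: "0 \<le> A i j" if "i \<in> {1..n}" "j \<in> {1..n}" for i j
    unfolding A_def using W that by (intro mat_prod_rev_nonneg) (auto simp: block_update_def)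
  have boundary: "mat_vec n (mat_power n A k) (\<lambda>_. 1) i \<le> lam ^ k" if "i \<in> D" for i k
    using that
  proof (induction k arbitrary: i)
    case 0
    then show ?case
      using D by (auto simp: mat_power_def mat_vec_mat_id)
  next
    case (Suc k)
    have "mat_vec n A (mat_vec n (mat_power n A k) (\<lambda>_. 1)) i \<le> lam * lam ^ k"
      unfolding A_def
      using D lam W Suc cover
      by (intro sweep_contracts_boundary[where D = D and S = "{}"]) (auto simp: A_def)
    then show ?case
      by (simp add: mat_power_Suc mat_vec_mat_mult)
  qed
  have row: "mat_vec n (mat_power n A (Suc k)) (\<lambda>_. 1) i \<le> lam ^ k * mat_norm_inf n A"
    if i: "i \<in> {1..n}" for i
  proof -
    have "mat_vec n (mat_power n A (Suc k)) (\<lambda>_. 1) i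
            = mat_vec n A (mat_vec n (mat_power n A k) (\<lambda>_. 1)) i"
      by (simp add: mat_power_Suc mat_vec_mat_mult)
    also have "\<dots> \<le> mat_vec n A (\<lambda>_. lam ^ k) i"
      unfolding A_def
      using D W boundary i cover
      by (intro sweep_mono[where D = D and S = "{}"]) (auto simp: A_def)
    also have "\<dots> = lam ^ k * mat_vec n A (\<lambda>_. 1) i"
      by (rule mat_vec_const)
    also have "\<dots> \<le> lam ^ k * mat_norm_inf n A"
      using lam(1) i mat_norm_inf_nonneg_matrix[OF n A0] by (intro mult_left_mono) auto
    finally show ?thesis .
  qed
  have "mat_norm_inf n (mat_power n A (Suc k)) = Max (mat_vec n (mat_power n A (Suc k)) (\<lambda>_. 1) ` {1..n})"
    using mat_power_nonneg[OF A0] by (intro mat_norm_inf_nonneg_matrix[OF n]) auto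
  then show ?thesis
    using row n by simp
qed


section \<open>The sweep of the ideal Gibbs sampler\<close>

theorem theorem4:
  fixes n :: nat
    and M :: "'a measure" and N :: "'b measure"
    and mu0 :: "'a \<Rightarrow> real" and m :: "'a \<Rightarrow> 'a \<Rightarrow> real" and g :: "'a \<Rightarrow> 'b \<Rightarrow> real"
    and y :: "nat \<Rightarrow> 'b"
    and Js :: "nat set list"
    and phi :: "nat set \<Rightarrow> (nat \<Rightarrow> 'a) \<Rightarrow> (nat \<Rightarrow> 'a) measure"
    and W :: "nat set \<Rightarrow> nat \<Rightarrow> nat \<Rightarrow> real"
    and lam :: real
  assumes n: "1 \<le> n"
    and hmm: "hidden_markov_model M N mu0 m g"
    and obs: "\<And>t. t \<in> {1..n} \<Longrightarrow> y t \<in> space N"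
    and normalizer: "0 < smoothing_normalizer n M mu0 m g y" "smoothing_normalizer n M mu0 m g y < \<infinity>"
    and cover: "\<Union> (set Js) = {1..n}"
    and conditionals: "\<And>J. J \<in> set Js \<Longrightarrow>
          block_conditional n M (joint_smoothing n M mu0 m g y) J (phi J)"
    and wasserstein: "\<And>J. J \<in> set Js \<Longrightarrow>
          wasserstein_matrix n M (gibbs_kernel n M J (phi J)) (W J)"
    and W_outside: "\<And>J i j. J \<in> set Js \<Longrightarrow> i \<in> {1..n} - J \<Longrightarrow> j \<in> {1..n} \<Longrightarrow>
          W J i j = (if i = j then 1 else 0)"
    and W_zero: "\<And>J i j. J \<in> set Js \<Longrightarrow> i \<in> J \<Longrightarrow> j \<in> {1..n} - boundary n J \<Longrightarrow> W J i j = 0"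
    and W_boundary: "\<And>J i j. J \<in> set Js \<Longrightarrow> i \<in> J \<Longrightarrow> j \<in> boundary n J \<Longrightarrow> W J i j \<in> {0..1}"
    and lam: "lam < 1"
    and contraction: "\<And>J. J \<in> set Js \<Longrightarrow>
          max_over (J \<inter> (\<Union>J' \<in> set Js. boundary n J')) (\<lambda>i. \<Sum>j \<in> boundary n J. W J i j) \<le> lam"
  defines "\<W> \<equiv> mat_prod_rev n (map W Js)"
    and "\<P> \<equiv> kernel_prod (path_space M {1..n}) (map (\<lambda>J. gibbs_kernel n M J (phi J)) Js)"
  shows "wasserstein_matrix n M \<P> \<W> \<and>
         (\<forall>k\<ge>1. mat_norm_inf n (mat_power n \<W> k) \<le> lam ^ (k - 1) * mat_norm_inf n \<W>)"
proof (intro conjI allI impI)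
  let ?D = "\<Union>J\<in>set Js. boundary n J"
  have D: "?D \<subseteq> {1..n}"
    by (auto simp: boundary_def)
  have J_sub: "J \<subseteq> {1..n}" if "J \<in> set Js" for J
    using cover that by blast
  have kernel: "gibbs_kernel n M J (phi J)
      \<in> path_space M {1..n} \<rightarrow>\<^sub>M subprob_algebra (path_space M {1..n})" if "J \<in> set Js" for J
    using conditionals[OF that] J_sub[OF that]
    by (intro gibbs_kernel_measurable)
      (auto simp: block_conditional_def regular_conditional_distribution_def)
  show "wasserstein_matrix n M \<P> \<W>"
    unfolding \<P>_def \<W>_def using kernel wasserstein by (rule wasserstein_matrix_kernel_prod)
  have row: "(\<Sum>j\<in>boundary n J. W J i j) \<le> lam" if "J \<in> set Js" "i \<in> J \<inter> ?D" for J i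
  proof -
    have "finite (J \<inter> ?D)"
      using D finite_subset by blast
    then have "(\<Sum>j\<in>boundary n J. W J i j) \<le> max_over (J \<inter> ?D) (\<lambda>i. \<Sum>j\<in>boundary n J. W J i j)"
      using that(2) unfolding max_over_def by (auto intro!: Max_ge simp del: UN_simps)
    then show ?thesis
      using contraction[OF that(1)] by linarith
  qed
  (* The maximum is over sums of nonnegative entries, or 0 by convention; one block exists as n > 0. *)
  have "0 \<le> lam"
  proof -
    obtain J where J: "J \<in> set Js"
      using cover n by fastforce
    show ?thesis
    proof (cases "J \<inter> ?D = {}")
      case True
      then show ?thesis
        using contraction[OF J] unfolding max_over_def by simp
    next
      case False
      then obtain i where i: "i \<in> J \<inter> ?D"
        by blast
      have "0 \<le> (\<Sum>j\<in>boundary n J. W J i j)"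
        using W_boundary[OF J] i by (intro sum_nonneg) auto
      then show ?thesis
        using row[OF J i] by linarith
    qed
  qed
  have block: "block_update n ?D lam J (W J)" if J: "J \<in> set Js" for J
  proof -
    have nonneg: "\<forall>i\<in>{1..n}. \<forall>j\<in>{1..n}. 0 \<le> W J i j"
      using wasserstein[OF J] unfolding wasserstein_matrix_def by blast
    have zero: "\<forall>i\<in>J. \<forall>j\<in>{1..n} - ?D. W J i j = 0"
      using W_zero[OF J] J by blast
    have "(\<Sum>j\<in>?D. W J i j) \<le> lam" if i: "i \<in> J \<inter> ?D" for i
    proof -
      have "(\<Sum>j\<in>?D. W J i j) = (\<Sum>j\<in>boundary n J. W J i j)"
        using D W_zero[OF J] i J finite_subset[OF D]
        by (intro sum.mono_neutral_right) blast+
      then show ?thesis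
        using row[OF J i] by linarith
    qed
    then show ?thesis
      unfolding block_update_def using J_sub[OF J] nonneg zero W_outside[OF J] by blast
  qed
  fix k :: nat
  assume "k \<ge> 1"
  then obtain l where "k = Suc l"
    by (cases k) auto
  then show "mat_norm_inf n (mat_power n \<W> k) \<le> lam ^ (k - 1) * mat_norm_inf n \<W>"
    unfolding \<W>_def using norm_power_sweep_le[OF n D \<open>0 \<le> lam\<close> _ block cover] lam by simp
qed

end
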